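(* Let $F_0$ be a formally real field and let $F=F_0(X,Y)$ be the rational function field in two commuting variables over $F_0$. Let $A=M_3(F)$ and $\sigma=\mathrm{ad}_q$, where $q$ is the quadratic form $q=\langle X,Y,XY\rangle$ over $F$. Then the ($\sigma$-symmetric) element $XY\in F\subseteq A$ is totally $\sigma$-positive, but it is not a sum of hermitian squares in $(A,\sigma)$.
   Context: For a quadratic form $q$ of dimension $n$ over $F$ with Gram matrix $H$ (for $q=\langle a_1,\dots,a_n\rangle$, $H=\mathrm{diag}(a_1,\dots,a_n)$), the adjoint involution $\mathrm{ad}_q$ on $M_n(F)$ is $\mathrm{ad}_q(Z)=H\cdot Z^t\cdot H^{-1}$, where $t$ is the transpose. The field $F$ is identified with the scalar matrices, so $XY$ means $XY\cdot I_3$. Put $\mathrm{Sym}(A,\sigma)=\{a\in A:\sigma(a)=a\}$ and let $\mathrm{Trd}:A\to F$ be the reduced trace (here the usual matrix trace). An ordering $\leq_P$ of the field $F$ is a $\sigma$-ordering if $0\leq_P\mathrm{Trd}(\sigma(x)x)$ for all $x\in A$. An element $a\in\mathrm{Sym}(A,\sigma)$ is $\sigma$-positive with respect to a $\sigma$-ordering $\leq_P$ if $0\leq_P \mathrm{Trd}(\sigma(x)ax)$ for all $x\in A$; it is totally $\sigma$-positive if it is $\sigma$-positive with respect to all $\sigma$-orderings of $F$. Hermitian squares in $(A,\sigma)$ are elements of the form $\sigma(x)x$ with $x\in A$; sums are finite. *)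

theory Defs
  imports "HOL-Analysis.Analysis" "HOL-Computational_Algebra.Fraction_Field"
    "HOL-Computational_Algebra.Polynomial"
begin

definition formally_real :: "'a::field itself \<Rightarrow> bool" where
  "formally_real _ \<longleftrightarrow> \<not> (\<exists>(n::nat) (x :: nat \<Rightarrow> 'a). (\<Sum>i<n. (x i)\<^sup>2) = - 1)"

text \<open>
  The rational function field in two variables over \<open>'a\<close> is the fraction field of the polynomial
  ring \<open>'a[X][Y]\<close>: the inner polynomial variable is \<open>X\<close>, the outer one is \<open>Y\<close>.
\<close>

type_synonym 'a ratfun2 = "'a poly poly fract"

definition varX :: "'a::field ratfun2" where
  "varX = Fract [:[:0, 1:]:] 1"

definition varY :: "'a::field ratfun2" where
  "varY = Fract [:0, 1:] 1"

text \<open>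
  A quadratic form is represented by its Gram matrix; \<open>diag_form a\<close> is the form
  \<open>\<langle>a\<^sub>1, \<dots>, a\<^sub>n\<rangle>\<close>.
\<close>

definition diag_form :: "'a::field ^ 'n \<Rightarrow> 'a ^ 'n ^ 'n" where
  "diag_form a = (\<chi> i j. if i = j then a $ i else 0)"

definition adj_inv :: "'a::field ^ 'n ^ 'n \<Rightarrow> 'a ^ 'n ^ 'n \<Rightarrow> 'a ^ 'n ^ 'n" where
  "adj_inv H Z = H ** transpose Z ** matrix_inv H"

definition Sym :: "('a::field ^ 'n ^ 'n \<Rightarrow> 'a ^ 'n ^ 'n) \<Rightarrow> ('a ^ 'n ^ 'n) set" where
  "Sym \<sigma> = {a. \<sigma> a = a}"

text \<open>
  Orderings of a field are arbitrary relations \<open>le\<close>, unrelated to any type class order.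
\<close>

definition field_ordering :: "('a::field \<Rightarrow> 'a \<Rightarrow> bool) \<Rightarrow> bool" where
  "field_ordering le \<longleftrightarrow>
     reflp le \<and> transp le \<and> antisymp le \<and> totalp le \<and>
     (\<forall>a b c. le a b \<longrightarrow> le (a + c) (b + c)) \<and>
     (\<forall>a b. le 0 a \<longrightarrow> le 0 b \<longrightarrow> le 0 (a * b))"

definition sigma_ordering ::
  "('a::field ^ 'n ^ 'n \<Rightarrow> 'a ^ 'n ^ 'n) \<Rightarrow> ('a \<Rightarrow> 'a \<Rightarrow> bool) \<Rightarrow> bool" where
  "sigma_ordering \<sigma> le \<longleftrightarrow>
     field_ordering le \<and> (\<forall>x. le 0 (trace (\<sigma> x ** x)))"

definition sigma_positive ::
  "('a::field ^ 'n ^ 'n \<Rightarrow> 'a ^ 'n ^ 'n) \<Rightarrow> ('a \<Rightarrow> 'a \<Rightarrow> bool) \<Rightarrow> 'a ^ 'n ^ 'n \<Rightarrow> bool" where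
  "sigma_positive \<sigma> le a \<longleftrightarrow>
     a \<in> Sym \<sigma> \<and> (\<forall>x. le 0 (trace (\<sigma> x ** a ** x)))"

definition totally_sigma_positive ::
  "('a::field ^ 'n ^ 'n \<Rightarrow> 'a ^ 'n ^ 'n) \<Rightarrow> 'a ^ 'n ^ 'n \<Rightarrow> bool" where
  "totally_sigma_positive \<sigma> a \<longleftrightarrow>
     a \<in> Sym \<sigma> \<and> (\<forall>le. sigma_ordering \<sigma> le \<longrightarrow> sigma_positive \<sigma> le a)"

definition sum_of_hermitian_squares ::
  "('a::field ^ 'n ^ 'n \<Rightarrow> 'a ^ 'n ^ 'n) \<Rightarrow> 'a ^ 'n ^ 'n \<Rightarrow> bool" where
  "sum_of_hermitian_squares \<sigma> a \<longleftrightarrow>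
     (\<exists>(m::nat) (x :: nat \<Rightarrow> 'a ^ 'n ^ 'n). a = (\<Sum>i<m. \<sigma> (x i) ** x i))"

end

theory Submission
  imports Defs
begin

text \<open>
  The \<open>(3,3)\<close> entry of a representation of \<open>XY\<close> as a sum of hermitian squares writes \<open>-1\<close> as a sum
  of elements \<open>-X u\<^sup>2\<close>, \<open>-Y u\<^sup>2\<close>, \<open>-XY u\<^sup>2\<close>. No ordering excludes this, but a
  semiordering does: an additive cone that is closed under multiplication by squares only. In
  polynomials, let such a cone prescribe the leading coefficient in a way that depends on the parity
  of the degree; since the leading terms of \<open>f\<^sup>2\<close>, \<open>X f\<^sup>2\<close>, \<open>Y f\<^sup>2\<close>, \<open>XY f\<^sup>2\<close> have different
  parities, the signs of \<open>1\<close>, \<open>X\<close>, \<open>Y\<close>, \<open>XY\<close> can be chosen independently.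
\<close>

section \<open>Pointed cones\<close>

text \<open>Membership of 1 is left out so that the negative of a cone is again a cone. Once 1 is
  known to lie in \<open>C\<close>, pointedness keeps -1 out of it.\<close>

definition pointed_cone :: "'a::comm_ring_1 set \<Rightarrow> bool" where
  "pointed_cone C \<longleftrightarrow> 0 \<in> C \<and> (\<forall>a\<in>C. \<forall>b\<in>C. a + b \<in> C) \<and>
     (\<forall>a\<in>C. \<forall>r. a * r\<^sup>2 \<in> C) \<and> (\<forall>a\<in>C. - a \<in> C \<longrightarrow> a = 0)"

lemma pointed_cone_uminus:
  assumes "pointed_cone C"
  shows "pointed_cone (uminus ` C)"
proof -
  have "a \<in> uminus ` C \<longleftrightarrow> - a \<in> C" for a
    by (metis add.inverse_inverse image_iff)
  then show ?thesis
    using assms unfolding pointed_cone_def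
    by (metis add.inverse_inverse add.inverse_neutral minus_add_distrib mult_minus_left)
qed

lemma pointed_cone_sum:
  assumes "pointed_cone C" and "\<And>i. i \<in> I \<Longrightarrow> f i \<in> C"
  shows "sum f I \<in> C"
  using assms(2)
  by (induction I rule: infinite_finite_induct)
    (use assms(1) in \<open>auto simp: pointed_cone_def\<close>)

section \<open>Sums of squares in a formally real field\<close>

inductive_set sums_of_squares :: "'a::comm_ring_1 set" where
  zero: "0 \<in> sums_of_squares"
| add_square: "a \<in> sums_of_squares \<Longrightarrow> a + x\<^sup>2 \<in> sums_of_squares"

lemma power2_in_sums_of_squares: "x\<^sup>2 \<in> sums_of_squares"
  using sums_of_squares.add_square[OF sums_of_squares.zero, of x] by simp

lemma sums_of_squares_add:
  assumes "a \<in> sums_of_squares" "b \<in> sums_of_squares"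
  shows "a + b \<in> sums_of_squares"
  using assms(2)
  by induction (simp_all add: assms(1) sums_of_squares.add_square flip: add.assoc)

lemma sums_of_squares_mult_square:
  assumes "a \<in> sums_of_squares"
  shows "a * r\<^sup>2 \<in> sums_of_squares"
  using assms
  by induction
    (simp_all add: sums_of_squares.intros distrib_right flip: power_mult_distrib)

lemma sums_of_squares_mult:
  assumes "a \<in> sums_of_squares" "b \<in> sums_of_squares"
  shows "a * b \<in> sums_of_squares"
  using assms(2)
  by induction
    (simp_all add: assms(1) sums_of_squares.zero distrib_left sums_of_squares_add
      sums_of_squares_mult_square)

text \<open>Links the inductive set, whose closure properties follow by rule induction, to the
  indexed sums in \<open>formally_real\<close>.\<close>

lemma sums_of_squares_imp_sum:
  assumes "a \<in> sums_of_squares"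
  shows "\<exists>(n::nat) x. a = (\<Sum>i<n. (x i)\<^sup>2)"
  using assms
proof induction
  case zero
  show ?case by (rule exI[of _ 0]) simp
next
  case (add_square a y)
  then obtain n :: nat and x where "a = (\<Sum>i<n. (x i)\<^sup>2)" by blast
  then have "a + y\<^sup>2 = (\<Sum>i<Suc n. ((x(n := y)) i)\<^sup>2)" by simp
  then show ?case by blast
qed

lemma pointed_cone_sums_of_squares:
  assumes "formally_real TYPE('a::field)"
  shows "pointed_cone (sums_of_squares :: 'a set)"
proof -
  have "a = 0" if a: "a \<in> sums_of_squares" "- a \<in> sums_of_squares" for a :: 'a
  proof (rule ccontr)
    assume "a \<noteq> 0"
    \<comment> \<open>A product of sums of squares times a square is a sum of squares, so a nonzero
      \<open>a\<close> with both signs would make -1 one.\<close>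
    then have "- 1 = a * - a * (inverse a)\<^sup>2"
      by (simp add: power2_eq_square field_simps)
    then have "- 1 \<in> (sums_of_squares :: 'a set)"
      using a by (metis sums_of_squares_mult sums_of_squares_mult_square)
    then show False
      using sums_of_squares_imp_sum[of "- 1 :: 'a"] assms unfolding formally_real_def by metis
  qed
  then show ?thesis
    unfolding pointed_cone_def
    by (auto simp: sums_of_squares.zero sums_of_squares_add sums_of_squares_mult_square)
qed

section \<open>Cones of polynomials and of fractions\<close>

definition poly_cone :: "'a::idom set \<Rightarrow> 'a set \<Rightarrow> 'a poly set" where
  "poly_cone A B = {f. f \<noteq> 0 \<longrightarrow> lead_coeff f \<in> (if even (degree f) then A else B)}"

text \<open>A square has even degree and a square as leading coefficient, so the parity of
  \<open>degree f\<close> survives and only \<open>lead_coeff f\<close> matters. Besides closure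
  under squares, this gives membership of the multiples of 1, -X, -Y and -XY by squares.\<close>

lemma poly_cone_mult_square:
  assumes "\<And>r. lead_coeff f * r\<^sup>2 \<in> (if even (degree f) then A else B)"
  shows "f * g\<^sup>2 \<in> poly_cone A B"
proof (cases "f = 0 \<or> g = 0")
  case True
  then show ?thesis by (auto simp: poly_cone_def)
next
  case False
  then have "even (degree (f * g\<^sup>2)) \<longleftrightarrow> even (degree f)"
    by (simp add: degree_mult_eq degree_power_eq)
  moreover have "lead_coeff (f * g\<^sup>2) = lead_coeff f * (lead_coeff g)\<^sup>2"
    by (simp only: lead_coeff_mult lead_coeff_power)
  ultimately show ?thesis
    using assms[of "lead_coeff g"] unfolding poly_cone_def by simp
qed

text \<open>Leading terms never cancel in a sum. If the degrees differ, the higher one wins; if they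
  agree, both leading coefficients lie in the same cone, and pointedness prevents them from being
  opposite.\<close>

lemma pointed_cone_poly_cone:
  assumes A: "pointed_cone A" and B: "pointed_cone B"
  shows "pointed_cone (poly_cone A B)"
proof -
  have add: "f + g \<in> poly_cone A B" if f: "f \<in> poly_cone A B" and g: "g \<in> poly_cone A B" for f g
  proof (cases "f = 0 \<or> g = 0")
    case True
    then show ?thesis using f g by auto
  next
    case False
    then have nz: "f \<noteq> 0" "g \<noteq> 0" by auto
    consider "degree f < degree g" | "degree g < degree f" | "degree f = degree g"
      by linarith
    then show ?thesis
    proof cases
      case 1
      then show ?thesis
        using g nz by (auto simp: poly_cone_def degree_add_eq_right coeff_eq_0)
    next
      case 2
      then show ?thesis
        using f nz by (auto simp: poly_cone_def degree_add_eq_left coeff_eq_0)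
    next
      case 3
      define C where "C = (if even (degree f) then A else B)"
      have C: "pointed_cone C" "lead_coeff f \<in> C" "lead_coeff g \<in> C"
        using A B f g nz 3 by (auto simp: C_def poly_cone_def)
      have "lead_coeff f + lead_coeff g \<noteq> 0"
        using C nz unfolding pointed_cone_def
        by (metis eq_neg_iff_add_eq_0 add.commute leading_coeff_0_iff)
      then have nonzero: "coeff (f + g) (degree f) \<noteq> 0"
        using 3 by simp
      then have deg: "degree (f + g) = degree f"
        using 3 degree_add_le[of f "degree f" g] le_degree[OF nonzero] by simp
      have "lead_coeff (f + g) \<in> C"
        using C 3 unfolding deg pointed_cone_def by simp
      then show ?thesis
        unfolding poly_cone_def C_def mem_Collect_eq deg by (rule impI)
    qed
  qed
  have "f * g\<^sup>2 \<in> poly_cone A B" if "f \<in> poly_cone A B" for f g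
  proof (cases "f = 0")
    case False
    with A B that show ?thesis
      by (intro poly_cone_mult_square) (auto simp: poly_cone_def pointed_cone_def)
  qed (simp add: poly_cone_def)
  moreover have "f = 0" if "f \<in> poly_cone A B" "- f \<in> poly_cone A B" for f
    using A B that unfolding poly_cone_def pointed_cone_def
    by (auto split: if_splits)
  moreover have "0 \<in> poly_cone A B"
    by (simp add: poly_cone_def)
  ultimately show ?thesis
    using add unfolding pointed_cone_def by blast
qed

text \<open>Denominators are squares so that the numerator alone carries the sign. Every fraction
  a/s has the form as/s^2, so this restricts only the signs.\<close>

definition fract_cone :: "'a::idom set \<Rightarrow> 'a fract set" where
  "fract_cone C = {Fract a (s\<^sup>2) | a s. a \<in> C \<and> s \<noteq> 0}"

lemma fract_coneI: "a \<in> C \<Longrightarrow> s \<noteq> 0 \<Longrightarrow> Fract a (s\<^sup>2) \<in> fract_cone C"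
  unfolding fract_cone_def by blast

lemma pointed_cone_fract_cone:
  assumes C: "pointed_cone C"
  shows "pointed_cone (fract_cone C)"
proof -
  have "Fract 0 (1\<^sup>2) \<in> fract_cone C"
    using C by (intro fract_coneI) (simp_all add: pointed_cone_def)
  then have "0 \<in> fract_cone C"
    by (simp add: fract_collapse)
  moreover have "u + v \<in> fract_cone C" if u_in: "u \<in> fract_cone C" and v_in: "v \<in> fract_cone C" for u v
  proof -
    obtain a s where u: "u = Fract a (s\<^sup>2)" "a \<in> C" "s \<noteq> 0"
      using u_in unfolding fract_cone_def by blast
    obtain b t where v: "v = Fract b (t\<^sup>2)" "b \<in> C" "t \<noteq> 0"
      using v_in unfolding fract_cone_def by blast
    have "u + v = Fract (a * t\<^sup>2 + b * s\<^sup>2) ((s * t)\<^sup>2)"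
      using u v by (simp add: power_mult_distrib)
    moreover have "a * t\<^sup>2 + b * s\<^sup>2 \<in> C"
      using C u v by (simp add: pointed_cone_def)
    ultimately show ?thesis
      using fract_coneI[of _ C "s * t"] u v by simp
  qed
  moreover have "u * r\<^sup>2 \<in> fract_cone C" if u_in: "u \<in> fract_cone C" for u r
  proof -
    obtain a s where u: "u = Fract a (s\<^sup>2)" "a \<in> C" "s \<noteq> 0"
      using u_in unfolding fract_cone_def by blast
    obtain b t where r: "r = Fract b t" "t \<noteq> 0"
      by (cases r) auto
    have "u * r\<^sup>2 = Fract (a * b\<^sup>2) ((s * t)\<^sup>2)"
      using u r by (simp add: power2_eq_square mult_ac)
    moreover have "a * b\<^sup>2 \<in> C"
      using C u by (simp add: pointed_cone_def)
    ultimately show ?thesis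
      using fract_coneI[of _ C "s * t"] u r by simp
  qed
  moreover have "u = 0" if u_in: "u \<in> fract_cone C" and minus_in: "- u \<in> fract_cone C" for u
  proof -
    obtain a s where u: "u = Fract a (s\<^sup>2)" "a \<in> C" "s \<noteq> 0"
      using u_in unfolding fract_cone_def by blast
    obtain b t where v: "- u = Fract b (t\<^sup>2)" "b \<in> C" "t \<noteq> 0"
      using minus_in unfolding fract_cone_def by blast
    \<comment> \<open>Clearing the square denominators turns the two memberships of \<open>u\<close>
      and \<open>- u\<close> into a pair of opposite elements of \<open>C\<close>.\<close>
    have "- (a * t\<^sup>2) = b * s\<^sup>2"
      using u v by (simp add: eq_fract)
    then have "a * t\<^sup>2 \<in> C" "- (a * t\<^sup>2) \<in> C"
      using C u v by (simp_all add: pointed_cone_def)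
    then have "a * t\<^sup>2 = 0"
      using C unfolding pointed_cone_def by blast
    then show ?thesis
      using u v by (simp add: fract_collapse)
  qed
  ultimately show ?thesis
    by (simp add: pointed_cone_def)
qed

lemma fract_cone_mult_square:
  assumes "\<And>g. f * g\<^sup>2 \<in> C"
  shows "Fract f 1 * u\<^sup>2 \<in> fract_cone C"
proof (cases u)
  case (Fract b t)
  then have "Fract f 1 * u\<^sup>2 = Fract (f * b\<^sup>2) (t\<^sup>2)"
    by (simp add: power2_eq_square)
  then show ?thesis
    using assms Fract by (simp add: fract_coneI)
qed

lemma ex_pointed_cone_ratfun2:
  assumes "formally_real TYPE('a::field)"
  obtains P :: "'a::field ratfun2 set" where "pointed_cone P" and "1 \<in> P"
    and "\<And>u. - varX * u\<^sup>2 \<in> P" and "\<And>u. - varY * u\<^sup>2 \<in> P"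
    and "\<And>u. - (varX * varY) * u\<^sup>2 \<in> P"
proof -
  define S where "S = (sums_of_squares :: 'a set)"
  define N where "N = uminus ` S"
  \<comment> \<open>The outer parity is that of the Y-degree, the inner one that of the X-degree. A
    leading monomial with both exponents even gets coefficients in \<open>S\<close>; the other three
    parity classes get coefficients in \<open>N\<close>. This makes squares positive and their
    multiples by X, Y and XY negative.\<close>
  define Q where "Q = poly_cone (poly_cone S N) (poly_cone N N)"
  have S: "pointed_cone S"
    unfolding S_def using assms by (rule pointed_cone_sums_of_squares)
  have N: "pointed_cone N"
    unfolding N_def using S by (rule pointed_cone_uminus)
  have sq: "r\<^sup>2 \<in> S" "- (r\<^sup>2) \<in> N" for r
    by (simp_all add: N_def S_def power2_in_sums_of_squares)
  \<comment> \<open>These are the shapes of the leading coefficients in Y of the four products in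
    \<open>outer\<close>, in the same order.\<close>
  have inner: "r\<^sup>2 \<in> poly_cone S N" "[:0, - 1:] * r\<^sup>2 \<in> poly_cone S N"
    "- (r\<^sup>2) \<in> poly_cone N N" "[:0, - 1:] * r\<^sup>2 \<in> poly_cone N N" for r
    using poly_cone_mult_square[of 1 S N r] poly_cone_mult_square[of "[:0, - 1:]" S N r]
      poly_cone_mult_square[of "- 1" N N r] poly_cone_mult_square[of "[:0, - 1:]" N N r] sq
    by (simp_all del: mult_pCons_left)
  have outer: "g\<^sup>2 \<in> Q" "[:[:0, - 1:]:] * g\<^sup>2 \<in> Q" "[:0, - 1:] * g\<^sup>2 \<in> Q"
    "[:0, [:0, - 1:]:] * g\<^sup>2 \<in> Q" for g
    unfolding Q_def
    using poly_cone_mult_square[of 1 "poly_cone S N" "poly_cone N N" g]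
      poly_cone_mult_square[of "[:[:0, - 1:]:]" "poly_cone S N" "poly_cone N N" g]
      poly_cone_mult_square[of "[:0, - 1:]" "poly_cone S N" "poly_cone N N" g]
      poly_cone_mult_square[of "[:0, [:0, - 1:]:]" "poly_cone S N" "poly_cone N N" g] inner
    by (simp_all del: mult_pCons_left)
  show ?thesis
  proof
    show "pointed_cone (fract_cone Q)"
      unfolding Q_def by (intro pointed_cone_fract_cone pointed_cone_poly_cone S N)
    show "1 \<in> fract_cone Q"
      using fract_coneI[OF outer(1)[of 1], of 1] by (simp add: fract_collapse)
    have vars: "- varX = Fract [:[:0, - 1:]:] (1 :: 'a poly poly)"
      "- varY = Fract [:0, - 1:] (1 :: 'a poly poly)"
      "- (varX * varY) = Fract [:0, [:0, - 1:]:] (1 :: 'a poly poly)"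
      by (simp_all add: varX_def varY_def)
    show "- varX * u\<^sup>2 \<in> fract_cone Q" "- varY * u\<^sup>2 \<in> fract_cone Q"
      "- (varX * varY) * u\<^sup>2 \<in> fract_cone Q" for u
      unfolding vars by (intro fract_cone_mult_square outer)+
  qed
qed

section \<open>The adjoint involution of a diagonal form\<close>

lemma matrix_inv_unique:
  fixes A :: "'a::semiring_1 ^ 'n ^ 'm" and B :: "'a ^ 'm ^ 'n"
  assumes "A ** B = mat 1" "B ** A = mat 1"
  shows "matrix_inv A = B"
proof -
  \<comment> \<open>\<open>matrix_inv\<close> is a choice of a two-sided inverse; \<open>B\<close>
    shows that one exists, and associativity then forces equality.\<close>
  have "A ** matrix_inv A = mat 1 \<and> matrix_inv A ** A = mat 1"
    unfolding matrix_inv_def by (rule someI[of _ B]) (use assms in simp)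
  then show ?thesis
    by (metis assms(1) matrix_mul_assoc matrix_mul_lid matrix_mul_rid)
qed

lemma diag_form_mult_nth: "(diag_form h ** Z) $ i $ j = h $ i * Z $ i $ j"
  by (simp add: diag_form_def matrix_matrix_mult_def mult_delta_left)

lemma mult_diag_form_nth: "(Z ** diag_form h) $ i $ j = Z $ i $ j * h $ j"
  by (simp add: diag_form_def matrix_matrix_mult_def mult_delta_right)

lemma matrix_inv_diag_form:
  assumes "\<And>i. h $ i \<noteq> 0"
  shows "matrix_inv (diag_form h) = diag_form (\<chi> i. inverse (h $ i))"
  by (rule matrix_inv_unique)
    (simp_all add: vec_eq_iff diag_form_mult_nth, simp_all add: diag_form_def mat_def assms)

lemma adj_inv_diag_form_nth:
  assumes "\<And>i. h $ i \<noteq> 0"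
  shows "adj_inv (diag_form h) Z $ i $ j = h $ i * Z $ j $ i / h $ j"
  by (simp add: adj_inv_def matrix_inv_diag_form[OF assms] mult_diag_form_nth diag_form_mult_nth
      transpose_def divide_inverse)

text \<open>For i = j the entry is a sum of squares weighted by h_i/h_k. Both the sign conditions on
  orderings and the obstruction to hermitian squares come from these weights.\<close>

lemma hermitian_square_nth:
  assumes "\<And>i. h $ i \<noteq> 0"
  shows "(adj_inv (diag_form h) Z ** Z) $ i $ j =
    (\<Sum>k\<in>UNIV. h $ i / h $ k * (Z $ k $ i * Z $ k $ j))"
  by (simp add: matrix_matrix_mult_def adj_inv_diag_form_nth[OF assms] mult_ac)

lemma mat_in_Sym_adj_inv_diag_form:
  assumes "\<And>i. h $ i \<noteq> 0"
  shows "mat c \<in> Sym (adj_inv (diag_form h))"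
  using assms by (simp add: Sym_def vec_eq_iff adj_inv_diag_form_nth[OF assms] mat_def)

lemma sigma_ordering_ratio_nonneg:
  fixes h :: "'a::field ^ 'n"
  assumes h: "\<And>i. h $ i \<noteq> 0" and le: "sigma_ordering (adj_inv (diag_form h)) le"
  shows "le 0 (h $ i / h $ k)"
proof -
  \<comment> \<open>The matrix unit E_ki isolates one weight: its hermitian square is (h_i/h_k)
    E_ii.\<close>
  define Z :: "'a ^ 'n ^ 'n" where "Z = (\<chi> a b. if a = k \<and> b = i then 1 else 0)"
  have "(adj_inv (diag_form h) Z ** Z) $ l $ l = (if l = i then h $ i / h $ k else 0)" for l
    unfolding hermitian_square_nth[OF h]
    by (cases "l = i") (simp_all add: Z_def mult_delta_right)
  then have "trace (adj_inv (diag_form h) Z ** Z) = h $ i / h $ k"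
    by (simp add: trace_def)
  then show ?thesis
    using le unfolding sigma_ordering_def by metis
qed

lemma mult_mat_nth:
  fixes Z :: "'a::comm_semiring_1 ^ 'n ^ 'm"
  shows "(Z ** mat c) $ i $ j = c * Z $ i $ j"
  by (simp add: matrix_matrix_mult_def mat_def mult_delta_right mult.commute)

lemma trace_mult_mat_mult:
  fixes A B :: "'a::comm_semiring_1 ^ 'n ^ 'n"
  shows "trace (A ** mat c ** B) = c * trace (A ** B)"
proof -
  have "(A ** mat c ** B) $ i $ i = c * (A ** B) $ i $ i" for i
    unfolding matrix_matrix_mult_def[of _ B]
    by (simp add: mult_mat_nth sum_distrib_left mult_ac)
  then show ?thesis
    by (simp add: trace_def sum_distrib_left)
qed

text \<open>A scalar pulls out of the trace, leaving \<open>c\<close> times a trace that is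
  nonnegative by the definition of a sigma-ordering.\<close>

lemma totally_sigma_positive_mat:
  assumes h: "\<And>i. h $ i \<noteq> 0"
    and c: "\<And>le. sigma_ordering (adj_inv (diag_form h)) le \<Longrightarrow> le 0 c"
  shows "totally_sigma_positive (adj_inv (diag_form h)) (mat c)"
proof -
  have "le 0 (c * trace (adj_inv (diag_form h) x ** x))"
    if le: "sigma_ordering (adj_inv (diag_form h)) le" for le x
  proof -
    have "le 0 (trace (adj_inv (diag_form h) x ** x))"
      using le unfolding sigma_ordering_def by blast
    then show ?thesis
      using le c[OF le] unfolding sigma_ordering_def field_ordering_def by blast
  qed
  then show ?thesis
    unfolding totally_sigma_positive_def sigma_positive_def trace_mult_mat_mult
    using mat_in_Sym_adj_inv_diag_form[OF h] by blast
qed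

section \<open>The element XY for the form <X, Y, XY>\<close>

theorem theorem3p2:
  fixes q :: "'a::field ratfun2 ^ 3 ^ 3"
    and \<sigma> :: "'a ratfun2 ^ 3 ^ 3 \<Rightarrow> 'a ratfun2 ^ 3 ^ 3"
  assumes "formally_real TYPE('a)"
  defines "q \<equiv> diag_form (vector [varX, varY, varX * varY])"
    and "\<sigma> \<equiv> adj_inv q"
  shows "mat (varX * varY) \<in> Sym \<sigma> \<and>
         totally_sigma_positive \<sigma> (mat (varX * varY)) \<and>
         \<not> sum_of_hermitian_squares \<sigma> (mat (varX * varY))"
proof -
  define h :: "'a ratfun2 ^ 3" where "h = vector [varX, varY, varX * varY]"
  have h_nth: "h $ 1 = varX" "h $ 2 = varY" "h $ 3 = varX * varY"
    by (simp_all add: h_def)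
  have nz: "varX \<noteq> (0 :: 'a ratfun2)" "varY \<noteq> (0 :: 'a ratfun2)"
    by (simp_all add: varX_def varY_def Zero_fract_def eq_fract)
  then have h_nz: "h $ i \<noteq> 0" for i
    using exhaust_3[of i] h_nth by auto
  have \<sigma>: "\<sigma> = adj_inv (diag_form h)"
    by (simp add: \<sigma>_def q_def h_def)
  have "le 0 (varX * varY :: 'a ratfun2)" if le: "sigma_ordering \<sigma> le" for le
  proof -
    \<comment> \<open>These two ratios are X and Y, so every sigma-ordering makes X, Y and hence XY
      nonnegative.\<close>
    have "le 0 (h $ 3 / h $ 2)" "le 0 (h $ 3 / h $ 1)"
      using le h_nz unfolding \<sigma> by (auto intro: sigma_ordering_ratio_nonneg)
    then have "le 0 (varX :: 'a ratfun2)" "le 0 (varY :: 'a ratfun2)"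
      using nz by (simp_all add: h_nth)
    then show ?thesis
      using le by (simp add: sigma_ordering_def field_ordering_def)
  qed
  then have pos: "totally_sigma_positive \<sigma> (mat (varX * varY))"
    unfolding \<sigma> by (intro totally_sigma_positive_mat h_nz)
  have "\<not> sum_of_hermitian_squares \<sigma> (mat (varX * varY))"
  proof
    assume "sum_of_hermitian_squares \<sigma> (mat (varX * varY))"
    then obtain m :: nat and x where x: "mat (varX * varY) = (\<Sum>l<m. \<sigma> (x l) ** x l)"
      unfolding sum_of_hermitian_squares_def by blast
    have "h $ 3 = (mat (varX * varY) :: 'a ratfun2 ^ 3 ^ 3) $ 3 $ 3"
      by (simp add: h_nth mat_def)
    also have "\<dots> = (\<Sum>l<m. \<Sum>k\<in>UNIV. h $ 3 / h $ k * (x l $ k $ 3)\<^sup>2)"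
      unfolding x \<sigma> by (simp add: hermitian_square_nth[OF h_nz] power2_eq_square)
    \<comment> \<open>Writing z^2/h_k as h_k (z/h_k)^2 turns the inverse weights into h_k.
      Cancelling h_3 = XY then represents 1 by sums of values of the form <X, Y, XY>.\<close>
    also have "\<dots> = h $ 3 * (\<Sum>l<m. \<Sum>k\<in>UNIV. h $ k * (x l $ k $ 3 / h $ k)\<^sup>2)"
      unfolding sum_distrib_left
      by (intro sum.cong refl) (simp add: h_nz power2_eq_square)
    finally have eq: "- 1 = (\<Sum>l<m. \<Sum>k\<in>UNIV. - h $ k * (x l $ k $ 3 / h $ k)\<^sup>2)"
      using h_nz[of 3] by (simp add: sum_negf)
    obtain P :: "'a ratfun2 set" where P: "pointed_cone P" "1 \<in> P"
      and varsP: "\<And>u. - varX * u\<^sup>2 \<in> P" "\<And>u. - varY * u\<^sup>2 \<in> P"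
        "\<And>u. - (varX * varY) * u\<^sup>2 \<in> P"
      using ex_pointed_cone_ratfun2[OF assms(1)] by blast
    have "- h $ k * u\<^sup>2 \<in> P" for k u
      using exhaust_3[of k] varsP by (elim disjE) (simp_all only: h_nth)
    then have "- 1 \<in> P"
      unfolding eq by (intro pointed_cone_sum P(1))
    then show False
      using P unfolding pointed_cone_def by (metis one_neq_zero)
  qed
  with pos show ?thesis
    by (simp add: totally_sigma_positive_def)
qed

end
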